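(* Let $p$ be an odd prime and let $a$ be a positive integer. Then $$\sum_{k=0}^{p^a-1}\binom{2p^a+k}{k}\binom{2k}{k}(-1)^k\equiv\left(\frac{p^a}{5}\right)\left(3-2\times 5^{p-1}\right)\pmod{p^2}.$$
   Context: $(-)$ denotes the Jacobi symbol (so $\left(\frac{p^a}{5}\right)=0$ when $p=5$). *)

theory Defs
  imports "HOL-Number_Theory.Number_Theory"
begin

(* The Jacobi symbol (a / n), meaningful for odd positive n: the product of the Legendre
   symbols (a / q) over the prime factors q of n, counted with multiplicity. *)
definition Jacobi :: "int \<Rightarrow> int \<Rightarrow> int" where
  "Jacobi a n = (\<Prod>q\<in>#prime_factorization n. Legendre a q)"

end

theory Submission
  imports Defs "HOL-Computational_Algebra.Formal_Power_Series"
begin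

text \<open>
  Write $n = p^a$ and $A = (1 - X)^n$. Since $p$ divides $\binom{n}{k}$ for $0 < k < n$, the
  coefficients of $(A - 1)^2$ below $X^n$ vanish modulo $p^2$, so that $A^{-2} \equiv 3 - 2A$ there.
  Dividing by $1 - X$ gives $\binom{2n+k}{k} \equiv 3 - 2(-1)^k\binom{n-1}{k}$ for $k < n$, and the
  sum becomes $3S - 2T$ with $S = \sum_{k<n} \binom{2k}{k}(-1)^k$ and
  $T = \sum_{k<n} \binom{n-1}{k}\binom{2k}{k}$.

  An exact formula for $S$ in terms of $\binom{2n}{i} \equiv 2\binom{n}{i}$ and Fibonacci numbers
  yields $S \equiv 2F_n - F_{2n}$. Two expansions of the middle coefficient of
  $(X^2 + 3X + 1)^{n-1} = ((X + \alpha)(X + \beta))^{n-1}$ give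
  $T = \sum_k \binom{n-1}{k}^2 \alpha^{n-1-k}\beta^k$, and replacing $\binom{n-1}{k}^2$ by
  $2(-1)^k\binom{n-1}{k} - 1$ yields $T \equiv 2 \cdot 5^{(n-1)/2} - F_{2n}$.

  Let $e$ be the Jacobi symbol and $L_n = 2F_{n+1} - F_n$, so that $F_{2n} = F_n L_n$. Modulo $p$
  we have $5^{(n-1)/2} \equiv F_n \equiv e$ and $L_n \equiv 1$. For $p \neq 5$, expanding the
  squares of these congruences and using $L_n^2 - 5F_n^2 = -4$ gives
  $6F_n - F_{2n} \equiv 5e$ and $2 \cdot 5^{(n-1)/2} \equiv e(1 + 5^{p-1})$ modulo $p^2$; for
  $p = 5$ both hold with $e = 0$.
\<close>

unbundle fps_syntax

section \<open>Binomial and Fibonacci identities\<close>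

lemma fps_nth_one_minus_X_power:
  "((1 - fps_X :: 'a :: comm_ring_1 fps) ^ n) $ k = (- 1) ^ k * of_nat (n choose k)"
proof (induction n arbitrary: k)
  case 0
  then show ?case by (cases k) auto
next
  case (Suc n)
  then show ?case
    by (cases k) (auto simp: algebra_simps)
qed

lemma fps_nth_const_plus_X_power:
  "((fps_const c + fps_X :: 'a :: comm_ring_1 fps) ^ n) $ k = of_nat (n choose k) * c ^ (n - k)"
proof (induction n arbitrary: k)
  case 0
  then show ?case by (cases k) auto
next
  case (Suc n)
  show ?case
  proof (cases k)
    case 0
    then show ?thesis by (simp add: Suc distrib_right)
  next
    case k: (Suc j)
    have "c * (of_nat (n choose Suc j) * c ^ (n - Suc j)) = of_nat (n choose Suc j) * c ^ (n - j)"
      by (cases "j < n") (auto simp: binomial_eq_0 mult.left_commute[of c] Suc_diff_Suc simp flip: power_Suc)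
    then show ?thesis by (simp add: Suc k distrib_right)
  qed
qed

text \<open>Multiplying by \<open>1 - fps_X\<close> takes differences of coefficients, and Pascal's
  rule turns these into the same series with \<open>m\<close> lowered by one.\<close>

lemma fps_binomial_diagonal_inverse:
  "Abs_fps (\<lambda>k. of_nat ((m + k) choose k)) * (1 - fps_X :: 'a :: comm_ring_1 fps) ^ Suc m = 1"
proof (induction m)
  case 0
  show ?case
    by (rule fps_ext) (auto simp: algebra_simps split: nat.split)
next
  case (Suc m)
  have "Abs_fps (\<lambda>k. of_nat ((Suc m + k) choose k)) * (1 - fps_X :: 'a fps)
      = Abs_fps (\<lambda>k. of_nat ((m + k) choose k))"
  proof (rule fps_ext)
    fix k
    show "(Abs_fps (\<lambda>k. of_nat ((Suc m + k) choose k)) * (1 - fps_X :: 'a fps)) $ k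
        = Abs_fps (\<lambda>k. of_nat ((m + k) choose k)) $ k"
      by (cases k) (auto simp: algebra_simps)
  qed
  then show ?case
    using Suc by (simp add: mult.assoc[symmetric])
qed

lemma geometric_fps:
  "Abs_fps (\<lambda>_. 1) * (1 - fps_X :: int fps) = 1"
  using fps_binomial_diagonal_inverse[of 0, where 'a = int] by simp

text \<open>A coefficient of a product below index \<open>n\<close> involves only coefficients below
  \<open>n\<close>, so divisibility of truncations multiplies. This is how squares of moduli
  arise.\<close>

lemma fps_mult_nth_dvd:
  fixes f g :: "'a :: comm_ring_1 fps"
  assumes "\<And>i. i < n \<Longrightarrow> q dvd f $ i" "\<And>i. i < n \<Longrightarrow> r dvd g $ i" "k < n"
  shows "q * r dvd (f * g) $ k"
  unfolding fps_mult_nth using assms by (intro dvd_sum mult_dvd_mono) auto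

text \<open>Both sides are the coefficient of X^m in ((X + \<alpha>)(X + \<beta>))^m: expand the
  linear factors separately, or write their product as (1 + X)^2 + (\<alpha> + \<beta> - 2)
  X.\<close>

lemma sum_binomial_square_powers:
  fixes \<alpha> \<beta> :: "'a :: comm_ring_1"
  assumes "\<alpha> * \<beta> = 1"
  shows "(\<Sum>k\<le>m. of_nat (m choose k) ^ 2 * \<alpha> ^ (m - k) * \<beta> ^ k)
       = (\<Sum>k\<le>m. of_nat (m choose k) * of_nat ((2 * k) choose k) * (\<alpha> + \<beta> - 2) ^ (m - k))"
proof -
  define P where "P = (fps_const \<alpha> + fps_X) * (fps_const \<beta> + fps_X)"
  have "P = fps_const (\<alpha> * \<beta>) + fps_const (\<alpha> + \<beta>) * fps_X + fps_X ^ 2"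
    by (simp add: P_def algebra_simps power2_eq_square del: fps_const_add flip: fps_const_add fps_const_mult)
  also have "\<dots> = (fps_const 1 + fps_X) ^ 2 + fps_const (\<alpha> + \<beta> - 2) * fps_X"
    by (simp add: assms algebra_simps power2_eq_square numeral_fps_const flip: fps_const_add fps_const_sub)
  finally have P: "P = (fps_const 1 + fps_X) ^ 2 + fps_const (\<alpha> + \<beta> - 2) * fps_X" .
  have Pm: "P ^ m = (\<Sum>k\<le>m. of_nat (m choose k) * ((fps_const 1 + fps_X) ^ 2) ^ k
                       * (fps_const (\<alpha> + \<beta> - 2) * fps_X) ^ (m - k))"
    unfolding P by (rule binomial_ring)
  have "(\<Sum>k\<le>m. of_nat (m choose k) ^ 2 * \<alpha> ^ (m - k) * \<beta> ^ k) = (P ^ m) $ m"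
    unfolding P_def power_mult_distrib fps_mult_nth fps_nth_const_plus_X_power atLeast0AtMost
    by (rule sum.cong) (auto simp: power2_eq_square algebra_simps binomial_symmetric[symmetric])
  also have "\<dots> = (\<Sum>k\<le>m. of_nat (m choose k) * of_nat ((2 * k) choose k) * (\<alpha> + \<beta> - 2) ^ (m - k))"
    unfolding Pm fps_sum_nth
  proof (rule sum.cong)
    fix k assume "k \<in> {..m}"
    have "of_nat (m choose k) * ((fps_const 1 + fps_X) ^ 2) ^ k * (fps_const (\<alpha> + \<beta> - 2) * fps_X) ^ (m - k)
       = fps_const (of_nat (m choose k) * (\<alpha> + \<beta> - 2) ^ (m - k)) * ((fps_const 1 + fps_X) ^ (2 * k) * fps_X ^ (m - k))"
      by (simp add: power_mult_distrib fps_of_nat mult_ac flip: power_mult fps_const_mult)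
    moreover have "\<dots> $ m = of_nat (m choose k) * (\<alpha> + \<beta> - 2) ^ (m - k) * of_nat ((2 * k) choose k)"
      using \<open>k \<in> {..m}\<close>
      by (simp only: fps_mult_left_const_nth fps_X_power_mult_right_nth fps_nth_const_plus_X_power) simp
    ultimately show "(of_nat (m choose k) * ((fps_const 1 + fps_X) ^ 2) ^ k * (fps_const (\<alpha> + \<beta> - 2) * fps_X) ^ (m - k)) $ m
       = of_nat (m choose k) * of_nat ((2 * k) choose k) * (\<alpha> + \<beta> - 2) ^ (m - k)"
      by (simp only: mult_ac)
  qed auto
  finally show ?thesis .
qed

section \<open>Binomial sums with Fibonacci weights\<close>

text \<open>Pascal's rule for a sum that may stop before the end of its row, for use when only half
  of an even row is summed.\<close>

lemma sum_binomial_Suc_truncated: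
  "(\<Sum>j\<le>Suc m. int (Suc n choose j) * f j)
     = (\<Sum>j\<le>Suc m. int (n choose j) * f j) + (\<Sum>j\<le>m. int (n choose j) * f (Suc j))"
  unfolding sum.atMost_Suc_shift by (simp add: distrib_right sum.distrib)

lemma sum_binomial_Suc:
  "(\<Sum>j\<le>Suc n. int (Suc n choose j) * f j)
     = (\<Sum>j\<le>n. int (n choose j) * f j) + (\<Sum>j\<le>n. int (n choose j) * f (Suc j))"
  unfolding sum_binomial_Suc_truncated by simp

text \<open>By Binet this is (1 - phi^2)^n = (-phi)^n for the golden ratio phi and its conjugate.
  The free offset \<open>r\<close> absorbs the shift by 2 in the induction.\<close>

lemma sum_binomial_fib_even_index:
  "(\<Sum>j\<le>n. int (n choose j) * ((- 1) ^ j * int (fib (2 * j + r)))) = (- 1) ^ n * int (fib (n + r))"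
proof (induction n arbitrary: r)
  case (Suc n)
  have "(\<Sum>j\<le>n. int (n choose j) * ((- 1) ^ Suc j * int (fib (2 * Suc j + r))))
     = - (\<Sum>j\<le>n. int (n choose j) * ((- 1) ^ j * int (fib (2 * j + (r + 2)))))"
    by (simp add: sum_negf[symmetric])
  then show ?case
    unfolding sum_binomial_Suc Suc.IH by (simp add: algebra_simps)
qed auto

text \<open>By Binet this reflects (2 phi - 1)^2 = 5 for the golden ratio phi. An odd power leaves
  one factor sqrt 5, which turns Fibonacci numbers into Lucas numbers.\<close>

lemma sum_binomial_fib_sqrt5:
  defines "G \<equiv> \<lambda>n r. \<Sum>j\<le>n. int (n choose j) * ((- 1) ^ (n + j) * 2 ^ j * int (fib (j + r)))"
  shows "G (Suc (2 * m)) r = 5 ^ m * (2 * int (fib (Suc r)) - int (fib r))"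
proof -
  have step: "G (Suc n) r = 2 * G n (Suc r) - G n r" for n r
  proof -
    have "(\<Sum>j\<le>n. int (n choose j) * ((- 1) ^ (Suc n + Suc j) * 2 ^ Suc j * int (fib (Suc j + r)))) = 2 * G n (Suc r)"
      unfolding G_def by (simp add: sum_distrib_left algebra_simps)
    moreover have "(\<Sum>j\<le>n. int (n choose j) * ((- 1) ^ (Suc n + j) * 2 ^ j * int (fib (j + r)))) = - G n r"
      unfolding G_def by (simp add: sum_negf[symmetric])
    ultimately show ?thesis
      by (subst G_def) (simp only: sum_binomial_Suc)
  qed
  show ?thesis
  proof (induction m arbitrary: r)
    case 0
    show ?case by (simp add: step) (simp add: G_def)
  next
    case (Suc m)
    \<comment> \<open>With E the shift of \<open>r\<close>, two steps apply (2E - 1)^2 = 4E^2 - 4E +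
      1, which is multiplication by 5 wherever E^2 = E + 1.\<close>
    have "G (Suc (2 * Suc m)) r = 4 * G (Suc (2*m)) (Suc (Suc r)) - 4 * G (Suc (2*m)) (Suc r) + G (Suc (2*m)) r"
      using step[of "Suc (Suc (2*m))"] step[of "Suc (2*m)"] by simp
    then show ?case unfolding Suc by (simp add: algebra_simps)
  qed
qed

lemma fib_4_plus: "fib (n + 4) = 3 * fib (Suc n) + 2 * fib n"
  by (simp add: numeral_eq_Suc)

text \<open>Induction on \<open>n\<close>: two Pascal steps lead from row \<open>2 * n + 2\<close>
  to row \<open>2 * n\<close>, and the recurrence of even-indexed Fibonacci numbers reduces the
  weights to the previous ones, up to a boundary term that supplies the new central binomial
  coefficient.\<close>

lemma sum_central_binomial_alternating:
  "(\<Sum>k<n. int ((2 * k) choose k) * (- 1) ^ (n + k))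
     = (\<Sum>i\<le>n. int ((2 * n) choose i) * ((- 1) ^ (n + i) * int (fib (2 * (n - i)))))"
proof (induction n)
  case (Suc n)
  define f where "f i = (- 1) ^ (Suc n + i) * int (fib (2 * (Suc n - i)))" for i
  \<comment> \<open>Truncated subtraction gives \<open>fib 0 = 0\<close>, so cutting the sums at
    \<open>n\<close> loses nothing.\<close>
  have f_0: "f i = 0" if "i > n" for i
    using that by (simp add: f_def)
  have f_Suc: "f (Suc i) = (- 1) ^ (n + i) * int (fib (2 * (n - i)))" for i
    by (simp add: f_def)
  \<comment> \<open>For \<open>i < n\<close> this is F_(2d+4) - 3 F_(2d+2) + F_(2d) = 0 up to sign.
    At \<open>i = n\<close> truncation breaks the recurrence and leaves -1.\<close>
  have rec: "f i + 2 * f (Suc i) + f (Suc (Suc i)) = - f (Suc i) - (if i = n then 1 else 0)"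
    if "i \<le> n" for i
  proof (cases "i = n")
    case True
    then show ?thesis by (simp add: f_def)
  next
    case False
    with that have "i < n" by simp
    then obtain d where d: "n = Suc (i + d)"
      using less_imp_Suc_add by blast
    have "n + i = Suc (d + 2 * i)"
      by (simp add: d)
    then have sgn: "(- 1 :: int) ^ (n + i) = - ((- 1) ^ d)"
      by (simp only: power_Suc power_add power_mult) simp
    have sub: "Suc n - i = d + 2" "Suc n - Suc i = d + 1" "Suc n - Suc (Suc i) = d"
      by (simp_all add: d)
    have "f i = (- 1) ^ d * int (fib (2 * d + 4))" "f (Suc i) = - ((- 1) ^ d * int (fib (2 * d + 2)))"
      "f (Suc (Suc i)) = (- 1) ^ d * int (fib (2 * d))"
      unfolding f_def sub by (simp_all add: sgn fib_4_plus)
    then show ?thesis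
      using False by (simp add: fib_4_plus distrib_left)
  qed
  have two: "2 * Suc n = Suc (Suc (2 * n))"
    by simp
  have "(\<Sum>i\<le>Suc n. int ((2 * Suc n) choose i) * f i)
      = (\<Sum>i\<le>Suc n. int (Suc (2 * n) choose i) * f i)
        + (\<Sum>i\<le>Suc n. int (Suc (2 * n) choose i) * f (Suc i))"
    unfolding two sum_binomial_Suc_truncated[of "Suc (2 * n)" f n] by (simp add: f_0 del: binomial_Suc_Suc)
  also have "\<dots> = (\<Sum>i\<le>n. int ((2 * n) choose i) * (f i + 2 * f (Suc i) + f (Suc (Suc i))))"
    unfolding sum_binomial_Suc_truncated by (simp add: f_0 algebra_simps sum.distrib sum_distrib_left)
  also have "\<dots> = (\<Sum>i\<le>n. - (int ((2 * n) choose i) * f (Suc i)) - (if i = n then int ((2 * n) choose n) else 0))"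
    by (rule sum.cong) (simp_all add: rec right_diff_distrib)
  also have "\<dots> = - (\<Sum>i\<le>n. int ((2 * n) choose i) * f (Suc i)) - int ((2 * n) choose n)"
    by (simp add: sum_subtractf sum_negf)
  also have "\<dots> = - (\<Sum>k<n. int ((2 * k) choose k) * (- 1) ^ (n + k)) - int ((2 * n) choose n)"
    unfolding f_Suc Suc.IH ..
  also have "\<dots> = (\<Sum>k<Suc n. int ((2 * k) choose k) * (- 1) ^ (Suc n + k))"
    by (simp add: sum_negf)
  finally show ?case by (simp only: f_def)
qed auto

section \<open>Congruences for rows of binomial coefficients\<close>

text \<open>From k C(n, k) = n C(n-1, k-1): if p did not divide C(p^a, k), all of p^a would divide
  k.\<close>

lemma prime_power_dvd_choose:
  assumes "prime (p :: nat)" "0 < k" "k < p ^ a"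
  shows "p dvd (p ^ a choose k)"
proof (rule ccontr)
  assume "\<not> p dvd (p ^ a choose k)"
  then have "coprime (p ^ a) (p ^ a choose k)"
    using assms(1) by (simp add: prime_imp_coprime)
  moreover have "p ^ a dvd k * (p ^ a choose k)"
    using times_binomial_minus1_eq[OF assms(2), of "p ^ a"] by simp
  ultimately have "p ^ a dvd k"
    by (simp add: coprime_dvd_mult_left_iff)
  then show False
    using assms(2,3) by (auto dest: dvd_imp_le)
qed

section \<open>Rows whose inner entries are all divisible by \<open>q\<close>\<close>

context
  fixes q :: int and n :: nat
  assumes row: "\<And>k. 0 < k \<Longrightarrow> k < n \<Longrightarrow> q dvd int (n choose k)"
    and pos: "n > 0"
begin

lemma dvd_one_minus_X_power_minus_1:
  assumes "k < n"
  shows "q dvd ((1 - fps_X :: int fps) ^ n - 1) $ k"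
  using row[of k] assms by (cases k) (auto simp: fps_nth_one_minus_X_power)

lemma square_dvd_one_minus_X_power_minus_1:
  assumes "k < n"
  shows "q ^ 2 dvd (((1 - fps_X :: int fps) ^ n - 1) ^ 2 * g) $ k"
proof -
  have "q * (q * 1) dvd (((1 - fps_X :: int fps) ^ n - 1) * (((1 - fps_X) ^ n - 1) * g)) $ k"
    by (rule fps_mult_nth_dvd[where n = n] dvd_one_minus_X_power_minus_1 assms | simp)+
  then show ?thesis by (simp add: power2_eq_square mult.assoc)
qed

text \<open>Compare coefficients in (A - 1)^2 = A^2 - 2A + 1 for A = (1 - X)^n.\<close>

lemma choose_double_cong:
  assumes "0 < k" "k < n"
  shows "[int ((2 * n) choose k) = 2 * int (n choose k)] (mod q ^ 2)"
proof -
  have eq: "((1 - fps_X :: int fps) ^ n - 1) ^ 2 * 1 = (1 - fps_X) ^ (2 * n) - (1 - fps_X) ^ n - (1 - fps_X) ^ n + 1"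
    by (simp add: power2_eq_square algebra_simps flip: power_add mult_2)
  have "(((1 - fps_X :: int fps) ^ n - 1) ^ 2 * 1) $ k = (- 1) ^ k * (int ((2 * n) choose k) - 2 * int (n choose k))"
    unfolding eq using assms by (simp add: fps_nth_one_minus_X_power numeral_fps_const right_diff_distrib)
  then have "q ^ 2 dvd (- 1) ^ k * (int ((2 * n) choose k) - 2 * int (n choose k))"
    using square_dvd_one_minus_X_power_minus_1[OF assms(2), of 1] by simp
  then show ?thesis
    by (cases "even k") (auto simp: cong_iff_dvd_diff dvd_diff_commute)
qed

lemma one_minus_X_power_mult_geometric:
  "(1 - fps_X :: int fps) ^ n * Abs_fps (\<lambda>_. 1) = (1 - fps_X) ^ (n - 1)"
proof -
  have "(1 - fps_X :: int fps) ^ n * Abs_fps (\<lambda>_. 1)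
      = (1 - fps_X) ^ (n - 1) * (Abs_fps (\<lambda>_. 1) * (1 - fps_X))"
    using pos by (cases n) (simp_all only: power_Suc mult_ac diff_Suc_1 less_irrefl)
  then show ?thesis by (simp add: geometric_fps)
qed

text \<open>Below X^n, (1 - X)^(n-1) = A / (1 - X) agrees with 1 / (1 - X) modulo
  \<open>q\<close>.\<close>

lemma choose_pred_cong:
  assumes "k < n"
  shows "[int ((n - 1) choose k) = (- 1) ^ k] (mod q)"
proof -
  have "q * 1 dvd (((1 - fps_X :: int fps) ^ n - 1) * Abs_fps (\<lambda>_. 1)) $ k"
    by (rule fps_mult_nth_dvd[where n = n] dvd_one_minus_X_power_minus_1 assms | simp)+
  then have "q dvd (- 1) ^ k * int ((n - 1) choose k) - 1"
    by (simp add: left_diff_distrib one_minus_X_power_mult_geometric fps_nth_one_minus_X_power)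
  then show ?thesis
    by (cases "even k") (auto simp: cong_iff_dvd_diff dvd_diff_commute dvd_minus_iff[of _ "_ + 1", symmetric])
qed

lemma choose_double_plus_cong:
  assumes "k < n"
  shows "[int ((2 * n + k) choose k) = 3 - 2 * ((- 1) ^ k * int ((n - 1) choose k))] (mod q ^ 2)"
proof -
  define y :: "int fps" where "y = 1 - fps_X"
  define D :: "int fps" where "D = Abs_fps (\<lambda>k. int ((2 * n + k) choose k))"
  define E :: "int fps" where "E = Abs_fps (\<lambda>_. 1)"
  have D: "D * y ^ (2 * n) * y = 1"
    using fps_binomial_diagonal_inverse[of "2 * n", where 'a = int] by (simp add: D_def y_def mult_ac)
  have E: "E * y = 1"
    using geometric_fps by (simp add: E_def y_def)
  have "E = (D * y ^ (2 * n) * y) * E"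
    using D by simp
  also have "\<dots> = D * y ^ (2 * n) * (E * y)"
    by (simp only: mult_ac)
  finally have ED: "E = D * (y ^ n * y ^ n)"
    using E by (simp add: mult_2 power_add)
  \<comment> \<open>The polynomial 1 - 3Y^2 + 2Y^3 = (Y - 1)^2 (2Y + 1) has a double root at 1. This
    form avoids inverting A = y^n.\<close>
  have sq: "D - 3 * (D * (Y * Y)) + 2 * (Y * (D * (Y * Y))) = (Y - 1) ^ 2 * ((2 * Y + 1) * D)" for Y
    by (simp add: algebra_simps power2_eq_square)
  have "D - 3 * E + 2 * (y ^ n * E) = (y ^ n - 1) ^ 2 * ((2 * y ^ n + 1) * D)"
    unfolding ED by (simp only: sq)
  then have "q ^ 2 dvd (D - 3 * E + 2 * (y ^ n * E)) $ k"
    using square_dvd_one_minus_X_power_minus_1[OF assms, folded y_def] by simp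
  moreover have "(D - 3 * E + 2 * (y ^ n * E)) $ k
      = int ((2 * n + k) choose k) - (3 - 2 * ((- 1) ^ k * int ((n - 1) choose k)))"
    unfolding D_def E_def y_def one_minus_X_power_mult_geometric
    by (simp add: fps_nth_one_minus_X_power numeral_fps_const)
  ultimately show ?thesis
    by (simp add: cong_iff_dvd_diff)
qed

lemma sum_central_binomial_alternating_cong:
  assumes "odd n"
  shows "[(\<Sum>k<n. int ((2 * k) choose k) * (- 1) ^ k) = 2 * int (fib n) - int (fib (2 * n))] (mod q ^ 2)"
proof -
  define v where "v i = (- 1) ^ (n + i) * int (fib (2 * (n - i)))" for i
  have "- (\<Sum>k<n. int ((2 * k) choose k) * (- 1) ^ k) = (\<Sum>i\<le>n. int ((2 * n) choose i) * v i)"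
    using sum_central_binomial_alternating[of n] assms by (simp add: v_def power_add sum_negf)
  \<comment> \<open>The replacement of C(2n, i) by 2 C(n, i) fails at both ends:
    \<open>i = 0\<close> gets a correction, while at \<open>i = n\<close> the weight is
    \<open>fib 0 = 0\<close>.\<close>
  also have "[\<dots> = (\<Sum>i\<le>n. (2 * int (n choose i) - (if i = 0 then 1 else 0)) * v i)] (mod q ^ 2)"
  proof (rule cong_sum)
    fix i assume "i \<in> {..n}"
    then consider "i = 0" | "i = n" | "0 < i" "i < n" by force
    then show "[int ((2 * n) choose i) * v i = (2 * int (n choose i) - (if i = 0 then 1 else 0)) * v i] (mod q ^ 2)"
      by cases (auto simp: v_def intro: cong_mult choose_double_cong)
  qed
  also have "(\<Sum>i\<le>n. (2 * int (n choose i) - (if i = 0 then 1 else 0)) * v i)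
      = 2 * (\<Sum>i\<le>n. int (n choose i) * v i) - (\<Sum>i\<le>n. if i = 0 then v i else 0)"
    by (simp add: left_diff_distrib sum_subtractf sum_distrib_left mult.assoc if_distrib[of "\<lambda>x. x * _"] cong: if_cong)
  also have "(\<Sum>i\<le>n. if i = 0 then v i else 0) = - int (fib (2 * n))"
    using assms by (simp add: v_def)
  also have "(\<Sum>i\<le>n. int (n choose i) * v i) = (\<Sum>j\<le>n. int (n choose j) * ((- 1) ^ j * int (fib (2 * j + 0))))"
  proof (rule sum.reindex_bij_witness[of _ "\<lambda>j. n - j" "\<lambda>j. n - j"])
    fix i assume "i \<in> {..n}"
    then have "n choose (n - i) = n choose i" "even (n + i) = even (n - i)"
      by (auto simp: binomial_symmetric[symmetric])
    then show "int (n choose (n - i)) * ((- 1) ^ (n - i) * int (fib (2 * (n - i) + 0))) = int (n choose i) * v i"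
      by (simp add: v_def minus_one_power_iff)
  qed auto
  also have "\<dots> = - int (fib n)"
    using assms unfolding sum_binomial_fib_even_index by simp
  finally show ?thesis
    by (simp add: cong_iff_dvd_diff dvd_diff_commute algebra_simps)
qed

text \<open>Modulo \<open>q\<close> only the end terms \<open>j = 0\<close> and \<open>j = n\<close>
  of the sum in \<open>sum_binomial_fib_sqrt5\<close> survive.\<close>

lemma fib_cong_5_power:
  assumes "odd n" "[2 ^ n = 2] (mod q)"
  shows "[2 * int (fib (n + r)) - int (fib r) = 5 ^ ((n - 1) div 2) * (2 * int (fib (Suc r)) - int (fib r))] (mod q)"
proof -
  obtain m where m: "n = Suc (2 * m)"
    using assms(1) by (metis oddE Suc_eq_plus1)
  define f where "f j = (- 1) ^ (n + j) * 2 ^ j * int (fib (j + r))" for j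
  have "[(\<Sum>j\<le>n. int (n choose j) * f j) = (\<Sum>j\<le>n. (if j = 0 then f j else 0) + (if j = n then f j else 0))] (mod q)"
  proof (rule cong_sum)
    fix j assume "j \<in> {..n}"
    then consider "j = 0" | "j = n" | "0 < j" "j < n" by force
    then show "[int (n choose j) * f j = (if j = 0 then f j else 0) + (if j = n then f j else 0)] (mod q)"
      using pos by cases (auto simp: cong_0_iff row)
  qed
  also have "(\<Sum>j\<le>n. (if j = 0 then f j else 0) + (if j = n then f j else 0)) = f 0 + f n"
    by (simp add: sum.distrib)
  also have "\<dots> = 2 ^ n * int (fib (n + r)) - int (fib r)"
    using assms(1) by (simp add: f_def)
  also have "[\<dots> = 2 * int (fib (n + r)) - int (fib r)] (mod q)"
    by (intro cong_diff cong_mult assms cong_refl)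
  finally show ?thesis
    using sum_binomial_fib_sqrt5[of m r] unfolding f_def m by (simp add: cong_sym_eq)
qed

end

section \<open>Central trinomial coefficients\<close>

text \<open>These sums and the even-indexed Fibonacci numbers share the recurrence h(m+2) = 3 h(m+1)
  - h(m).\<close>

lemma sum_powers_fib:
  fixes \<alpha> \<beta> :: "'a :: comm_ring_1"
  assumes "\<alpha> + \<beta> = 3" "\<alpha> * \<beta> = 1"
  shows "(\<Sum>k\<le>m. \<alpha> ^ (m - k) * \<beta> ^ k) = of_nat (fib (2 * m + 2))"
proof -
  define h where "h m = (\<Sum>k\<le>m. \<alpha> ^ (m - k) * \<beta> ^ k)" for m
  have h_Suc: "h (Suc m) = \<alpha> * h m + \<beta> ^ Suc m" for m
    by (simp add: h_def sum_distrib_left Suc_diff_le mult.assoc)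
  have h_Suc_Suc: "h (Suc (Suc m)) = 3 * h (Suc m) - h m" for m
  proof -
    have "h (Suc (Suc m)) = \<alpha> * h (Suc m) + \<beta> * (h (Suc m) - \<alpha> * h m)"
      using h_Suc[of "Suc m"] h_Suc[of m] by simp
    also have "\<dots> = (\<alpha> + \<beta>) * h (Suc m) - (\<alpha> * \<beta>) * h m"
      by (simp add: algebra_simps)
    finally show ?thesis by (simp add: assms)
  qed
  have "h m = of_nat (fib (2 * m + 2))"
  proof (induction m rule: fib.induct)
    case 1
    show ?case by (simp add: h_def)
  next
    case 2
    have "h (Suc 0) = \<alpha> + \<beta>" by (simp add: h_def)
    then show ?case by (simp add: assms numeral_eq_Suc)
  next
    case (3 m)
    then show ?case by (simp add: h_Suc_Suc algebra_simps)
  qed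
  then show ?thesis by (simp add: h_def)
qed

lemma power_sum_in_Ints:
  fixes \<alpha> \<beta> :: real
  assumes "\<alpha> + \<beta> \<in> \<int>" "\<alpha> * \<beta> \<in> \<int>"
  shows "\<alpha> ^ i + \<beta> ^ i \<in> \<int>"
proof (induction i rule: fib.induct)
  case (3 i)
  have "\<alpha> ^ Suc (Suc i) + \<beta> ^ Suc (Suc i)
      = (\<alpha> + \<beta>) * (\<alpha> ^ Suc i + \<beta> ^ Suc i) - (\<alpha> * \<beta>) * (\<alpha> ^ i + \<beta> ^ i)"
    by (simp add: algebra_simps)
  then show ?case
    using 3 assms by (metis Ints_diff Ints_mult)
qed (use assms in auto)

lemma mixed_power_sum_in_Ints:
  fixes \<alpha> \<beta> :: real
  assumes "\<alpha> + \<beta> \<in> \<int>" "\<alpha> * \<beta> \<in> \<int>"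
  shows "\<alpha> ^ i * \<beta> ^ j + \<alpha> ^ j * \<beta> ^ i \<in> \<int>"
proof (induction i j rule: linorder_wlog)
  case (le i j)
  then obtain d where d: "j = i + d"
    using le_Suc_ex by blast
  have "\<alpha> ^ i * \<beta> ^ j + \<alpha> ^ j * \<beta> ^ i = (\<alpha> * \<beta>) ^ i * (\<alpha> ^ d + \<beta> ^ d)"
    by (simp add: d power_add power_mult_distrib algebra_simps)
  then show ?case
    using assms by (simp add: power_sum_in_Ints)
qed (simp add: add.commute)

text \<open>Doubling pairs index \<open>k\<close> with \<open>m - k\<close> without a special case
  for a middle term. The factor 2 is later cancelled against an odd modulus.\<close>

lemma double_symmetric_power_sum_in_Ints:
  fixes \<alpha> \<beta> :: real and s :: "nat \<Rightarrow> int"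
  assumes "\<alpha> + \<beta> \<in> \<int>" "\<alpha> * \<beta> \<in> \<int>" and sym: "\<And>k. k \<le> m \<Longrightarrow> s (m - k) = s k"
  shows "2 * (\<Sum>k\<le>m. of_int (s k) * (\<alpha> ^ (m - k) * \<beta> ^ k)) \<in> \<int>"
proof -
  have "(\<Sum>k\<le>m. of_int (s k) * (\<alpha> ^ (m - k) * \<beta> ^ k)) = (\<Sum>k\<le>m. of_int (s k) * (\<alpha> ^ k * \<beta> ^ (m - k)))"
    by (rule sum.reindex_bij_witness[of _ "\<lambda>k. m - k" "\<lambda>k. m - k"]) (auto simp: sym)
  then have "2 * (\<Sum>k\<le>m. of_int (s k) * (\<alpha> ^ (m - k) * \<beta> ^ k))
      = (\<Sum>k\<le>m. of_int (s k) * (\<alpha> ^ (m - k) * \<beta> ^ k + \<alpha> ^ k * \<beta> ^ (m - k)))"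
    by (simp add: distrib_left sum.distrib)
  also have "\<dots> \<in> \<int>"
    by (intro Ints_sum Ints_mult mixed_power_sum_in_Ints assms) auto
  finally show ?thesis .
qed

text \<open>The difference of the two sides is the sum of (C(m, k) - (-1)^k)^2 \<alpha>^(m-k)
  \<beta>^k, whose integer weights are divisible by q^2. Symmetry in \<alpha> and \<beta> shows that
  twice the quotient is an integer.\<close>

lemma sum_choose_central_binomial_cong:
  fixes q :: int
  assumes m: "even m" and q: "odd q"
    and pred: "\<And>k. k \<le> m \<Longrightarrow> [int (m choose k) = (- 1) ^ k] (mod q)"
  shows "[(\<Sum>k\<le>m. int (m choose k) * int ((2 * k) choose k))
           = 2 * 5 ^ (m div 2) - int (fib (2 * m + 2))] (mod q ^ 2)"
proof -
  \<comment> \<open>The roots of x^2 - 3x + 1: then \<alpha> + \<beta> - 2 = 1, and (\<alpha> -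
    \<beta>)^m is a power of 5 for even \<open>m\<close>.\<close>
  define \<alpha> \<beta> :: real where "\<alpha> = (3 + sqrt 5) / 2" and "\<beta> = (3 - sqrt 5) / 2"
  have ab: "\<alpha> + \<beta> = 3" "\<alpha> * \<beta> = 1" "\<alpha> - \<beta> = sqrt 5"
    by (auto simp: \<alpha>_def \<beta>_def field_simps)
  define w where "w k = (int (m choose k) - (- 1) ^ k) ^ 2" for k
  define s where "s k = w k div q ^ 2" for k
  have w: "w k = q ^ 2 * s k" if "k \<le> m" for k
    using pred[OF that] by (simp add: s_def w_def cong_iff_dvd_diff)
  have s_sym: "s (m - k) = s k" if "k \<le> m" for k
  proof -
    have "even (m - k) \<longleftrightarrow> even k"
      using m that by auto
    then show ?thesis
      using that by (simp add: s_def w_def binomial_symmetric[symmetric] minus_one_power_iff)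
  qed
  obtain z where z: "2 * (\<Sum>k\<le>m. real_of_int (s k) * (\<alpha> ^ (m - k) * \<beta> ^ k)) = of_int z"
    using double_symmetric_power_sum_in_Ints[of \<alpha> \<beta> m s] s_sym by (auto simp: ab elim: Ints_cases)
  define T where "T = (\<Sum>k\<le>m. int (m choose k) * int ((2 * k) choose k))"
  have "real_of_int T = (\<Sum>k\<le>m. of_nat (m choose k) ^ 2 * \<alpha> ^ (m - k) * \<beta> ^ k)"
    unfolding sum_binomial_square_powers[OF ab(2)] by (simp add: ab T_def)
  moreover have "5 ^ (m div 2) = (\<Sum>k\<le>m. of_nat (m choose k) * (- 1) ^ k * (\<alpha> ^ (m - k) * \<beta> ^ k))"
  proof -
    have "(5 :: real) ^ (m div 2) = (sqrt 5 ^ 2) ^ (m div 2)"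
      by simp
    also have "\<dots> = (\<alpha> - \<beta>) ^ m"
      unfolding ab power_mult[symmetric] using m by simp
    also have "\<dots> = (- \<beta> + \<alpha>) ^ m"
      by simp
    also have "\<dots> = (\<Sum>k\<le>m. of_nat (m choose k) * (- \<beta>) ^ k * \<alpha> ^ (m - k))"
      by (rule binomial_ring)
    also have "\<dots> = (\<Sum>k\<le>m. of_nat (m choose k) * (- 1) ^ k * (\<alpha> ^ (m - k) * \<beta> ^ k))"
      by (rule sum.cong) (auto simp: power_minus[of \<beta>])
    finally show ?thesis .
  qed
  moreover note sum_powers_fib[OF ab(1,2), of m, symmetric]
  moreover define X where "X = T - (2 * 5 ^ (m div 2) - int (fib (2 * m + 2)))"
  ultimately have "real_of_int X
      = (\<Sum>k\<le>m. of_nat (m choose k) ^ 2 * \<alpha> ^ (m - k) * \<beta> ^ k)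
        - (2 * (\<Sum>k\<le>m. of_nat (m choose k) * (- 1) ^ k * (\<alpha> ^ (m - k) * \<beta> ^ k))
           - (\<Sum>k\<le>m. \<alpha> ^ (m - k) * \<beta> ^ k))"
    by simp
  also have "\<dots> = (\<Sum>k\<le>m. of_int (w k) * (\<alpha> ^ (m - k) * \<beta> ^ k))"
    unfolding sum_distrib_left sum_subtractf[symmetric]
    by (rule sum.cong) (auto simp: w_def algebra_simps power2_eq_square simp flip: power_add mult_2)
  also have "\<dots> = of_int (q ^ 2) * (\<Sum>k\<le>m. of_int (s k) * (\<alpha> ^ (m - k) * \<beta> ^ k))"
    unfolding sum_distrib_left by (rule sum.cong) (auto simp: w)
  finally have X: "real_of_int X = of_int (q ^ 2) * (\<Sum>k\<le>m. of_int (s k) * (\<alpha> ^ (m - k) * \<beta> ^ k))" .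
  have "real_of_int (2 * X) = of_int (q ^ 2 * z)"
    unfolding of_int_mult X z[symmetric] by simp
  then have "q ^ 2 dvd 2 * X"
    unfolding of_int_eq_iff by simp
  moreover have "coprime (q ^ 2) 2"
    using q by simp
  ultimately show ?thesis
    unfolding T_def[symmetric] cong_iff_dvd_diff X_def[symmetric] by (simp add: coprime_dvd_mult_right_iff)
qed

section \<open>Powers of 5 and Fibonacci numbers\<close>

lemma Legendre_cases: "Legendre x p \<in> {-1, 0, 1}"
  by (simp add: Legendre_def)

text \<open>Euler's criterion gives the equality modulo \<open>p\<close>. Both sides lie in {-1, 0,
  1}, so they differ by at most 2 < \<open>p\<close>.\<close>

lemma Legendre_power:
  assumes "prime p" "2 < p"
  shows "Legendre (x ^ a) (int p) = Legendre x (int p) ^ a"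
proof -
  have "[Legendre (x ^ a) p = (x ^ a) ^ ((p - 1) div 2)] (mod p)"
    using assms by (rule euler_criterion)
  also have "(x ^ a) ^ ((p - 1) div 2) = (x ^ ((p - 1) div 2)) ^ a"
    by (simp add: mult.commute flip: power_mult)
  also have "[\<dots> = Legendre x p ^ a] (mod p)"
    using assms by (intro cong_pow cong_sym[OF euler_criterion])
  finally have "int p dvd Legendre (x ^ a) p - Legendre x p ^ a"
    by (simp add: cong_iff_dvd_diff)
  moreover have "Legendre x p ^ a \<in> {-1, 0, 1}"
    using Legendre_cases[of x p] by (auto simp: minus_one_power_iff power_0_left split: if_splits)
  then have "\<bar>Legendre (x ^ a) p - Legendre x p ^ a\<bar> < int p"
    using Legendre_cases[of "x ^ a" p] assms(2) by (auto simp: power_0_left minus_one_power_iff)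
  ultimately show ?thesis
    using dvd_imp_le_int[of "Legendre (x ^ a) p - Legendre x p ^ a" "int p"] by linarith
qed

lemma Jacobi_power_5: "Jacobi (int (p ^ a)) 5 = Legendre (int p) 5 ^ a"
proof -
  have "prime_factorization (5 :: int) = {#5#}"
    by (rule prime_factorization_prime) simp
  then show ?thesis
    using Legendre_power[of 5 "int p" a] by (simp add: Jacobi_def)
qed

text \<open>The reciprocity sign is trivial because 5 is 1 modulo 4.\<close>

lemma Legendre_5_eq:
  assumes "prime p" "odd p"
  shows "Legendre 5 (int p) = Legendre (int p) 5"
proof (cases "p = 5")
  case False
  have p: "2 < p"
    using assms prime_gt_1_nat[of p] by (cases "p = 2") auto
  then have "Legendre 5 (int p) * Legendre (int p) 5 = 1"
    using Quadratic_Reciprocity[of 5 p] False assms(1) by simp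
  then show ?thesis
    using Legendre_cases[of 5 p] Legendre_cases[of p 5] by auto
qed simp

section \<open>Powers modulo p and p^2\<close>

lemma half_pred_power_Suc:
  assumes "odd (p :: nat)"
  shows "(p ^ Suc a - 1) div 2 = (p ^ a - 1) div 2 * p + (p - 1) div 2"
proof -
  obtain r where r: "p = 2 * r + 1"
    using assms by (rule oddE)
  obtain t where t: "p ^ a = 2 * t + 1"
    using assms by (metis even_power oddE)
  have Suc_a: "p ^ Suc a = 2 * (t * p + r) + 1"
    by (simp add: t algebra_simps) (simp add: r)
  show ?thesis
    unfolding Suc_a t by (simp add: r)
qed

text \<open>Splitting the exponent leaves a p-th power, which fixes -1, 0 and 1 for odd
  \<open>p\<close>, and a factor given by Euler's criterion.\<close>

lemma five_power_half_cong:
  assumes "prime p" "odd p"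
  shows "[5 ^ ((p ^ a - 1) div 2) = Legendre (int p) 5 ^ a] (mod (int p))"
proof (induction a)
  case (Suc a)
  have p: "2 < p"
    using assms prime_gt_1_nat[of p] by (cases "p = 2") auto
  define r where "r = Legendre (int p) 5"
  have r: "(r ^ a) ^ p = r ^ a"
    using Legendre_cases[of p 5] p assms(2)
    by (auto simp: r_def minus_one_power_iff power_0_left)
  have "[(5 ^ ((p ^ a - 1) div 2)) ^ p * 5 ^ ((p - 1) div 2) = (r ^ a) ^ p * r] (mod (int p))"
    using Suc euler_criterion[OF assms(1) p, of 5] Legendre_5_eq[OF assms]
    by (intro cong_mult cong_pow) (auto simp: r_def cong_sym_eq)
  then show ?case
    unfolding half_pred_power_Suc[OF assms(2)] power_add power_mult r by (simp add: r_def mult.commute)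
qed auto

text \<open>Successive exponents differ by multiples of \<open>p * (p - 1)\<close>, the totient of
  p^2.\<close>

lemma five_power_pred_cong:
  assumes "prime p" "p \<noteq> 5" "a > 0"
  shows "[5 ^ (p ^ a - 1) = 5 ^ (p - 1)] (mod (int p) ^ 2)"
proof -
  have "coprime 5 p"
    using assms(1,2) primes_coprime[of 5 p] by simp
  then have "[5 ^ totient (p ^ 2) = 1] (mod p ^ 2)"
    by (intro euler_theorem) simp
  then have "[int (5 ^ totient (p ^ 2)) = int 1] (mod int (p ^ 2))"
    by (subst cong_int_iff)
  then have euler: "[5 ^ (p * (p - 1)) = 1] (mod (int p) ^ 2)"
    using assms(1) by (simp add: totient_prime_power)
  have "[5 ^ (p ^ Suc b - 1) = 5 ^ (p - 1)] (mod (int p) ^ 2)" for b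
  proof (induction b)
    case (Suc b)
    obtain r where r: "p = Suc r"
      using assms(1) prime_gt_0_nat[of p] gr0_implies_Suc by blast
    obtain t where t: "p ^ b = Suc t"
      using assms(1) prime_gt_0_nat[of p] by (metis gr0_implies_Suc zero_less_power)
    have "p ^ Suc (Suc b) - 1 = (p ^ Suc b - 1) + p * (p - 1) * p ^ b"
      by (simp add: t) (simp add: r algebra_simps)
    then have "(5 :: int) ^ (p ^ Suc (Suc b) - 1) = 5 ^ (p ^ Suc b - 1) * (5 ^ (p * (p - 1))) ^ p ^ b"
      by (simp only: power_add power_mult)
    also have "[\<dots> = 5 ^ (p - 1) * 1 ^ p ^ b] (mod (int p) ^ 2)"
      by (intro cong_mult cong_pow Suc euler)
    finally show ?case by simp
  qed simp
  then show ?thesis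
    using assms(3) by (cases a) auto
qed

lemma Legendre_5_power_square:
  assumes "prime p" "p \<noteq> 5"
  shows "Legendre (int p) 5 ^ a * Legendre (int p) 5 ^ a = 1"
proof -
  have "\<not> 5 dvd p"
    using assms primes_dvd_imp_eq[of 5 p] by auto
  then have "\<not> 5 dvd int p"
    by presburger
  then show ?thesis
    by (auto simp: Legendre_def cong_0_iff minus_one_power_iff)
qed

lemma two_power_prime_power_cong:
  assumes "prime p" "odd p"
  shows "[2 ^ p ^ a = 2] (mod (int p))"
proof (induction a)
  case (Suc a)
  have "\<not> p dvd 2"
    using assms primes_dvd_imp_eq[of p 2] by auto
  then have "[int (2 ^ (p - 1)) = int 1] (mod int p)"
    by (subst cong_int_iff) (rule fermat_theorem[OF assms(1)])
  then have "[2 * 2 ^ (p - 1) = 2 * 1] (mod (int p))"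
    by (intro cong_mult cong_refl) simp
  moreover have "(2 :: int) * 2 ^ (p - 1) = 2 ^ p"
    using assms(2) by (simp add: odd_pos flip: power_Suc)
  ultimately have fermat: "[2 ^ p = 2] (mod (int p))"
    by simp
  have "(2 :: int) ^ p ^ Suc a = (2 ^ p ^ a) ^ p"
    by (simp add: mult.commute flip: power_mult)
  also have "[\<dots> = 2 ^ p] (mod (int p))"
    by (intro cong_pow Suc)
  also note fermat
  finally show ?case .
qed simp

text \<open>For \<open>p\<close> other than 5, expand (c - e)^2 modulo p^2 with c^2 congruent to
  5^(p-1) and e^2 = 1, then multiply by \<open>e\<close>. For \<open>p = 5\<close> the exponent is
  at least 2, so both sides vanish.\<close>

lemma five_power_half_double_cong:
  fixes p a :: nat
  assumes "prime p" "odd p" "a > 0"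
  defines "e \<equiv> Legendre (int p) 5 ^ a"
  shows "[2 * 5 ^ ((p ^ a - 1) div 2) = e * (1 + 5 ^ (p - 1))] (mod (int p) ^ 2)"
proof (cases "p = 5")
  case True
  have "(4 :: nat) \<le> 5 ^ a - 1"
    using power_increasing[of 1 a "5 :: nat"] assms(3) by simp
  then have "(2 :: nat) \<le> (5 ^ a - 1) div 2"
    by simp
  then have "(5 :: int) ^ 2 dvd 5 ^ ((5 ^ a - 1) div 2)"
    by (rule le_imp_power_dvd)
  then have "(5 :: int) ^ 2 dvd 2 * 5 ^ ((5 ^ a - 1) div 2)"
    by (rule dvd_mult)
  moreover have "e = 0"
    using assms(3) True by (simp add: e_def Legendre_def cong_def)
  ultimately show ?thesis
    using True by (simp add: cong_0_iff)
next
  case False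
  define c :: int where "c = 5 ^ ((p ^ a - 1) div 2)"
  have e2: "e * e = 1"
    using Legendre_5_power_square[OF assms(1) False, of a] by (simp add: e_def)
  have "int p dvd c - e"
    using five_power_half_cong[OF assms(1,2), of a] by (simp add: c_def e_def cong_iff_dvd_diff)
  then have "int p ^ 2 dvd (c - e) ^ 2"
    by simp
  moreover have "int p ^ 2 dvd c ^ 2 - 5 ^ (p - 1)"
  proof -
    have "even (p ^ a - 1)"
      using assms(2) by simp
    then have "c ^ 2 = 5 ^ (p ^ a - 1)"
      by (simp add: c_def flip: power_mult)
    then show ?thesis
      using five_power_pred_cong[OF assms(1) False assms(3)] by (simp add: cong_iff_dvd_diff)
  qed
  ultimately have "int p ^ 2 dvd e * ((c ^ 2 - 5 ^ (p - 1)) - (c - e) ^ 2)"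
    by (intro dvd_mult dvd_diff[of _ "c ^ 2 - 5 ^ (p - 1)"])
  also have "e * ((c ^ 2 - 5 ^ (p - 1)) - (c - e) ^ 2) = 2 * (e * e) * c - e * 5 ^ (p - 1) - e * (e * e)"
    by (simp add: power2_eq_square algebra_simps)
  finally show ?thesis
    unfolding e2 by (simp add: c_def cong_iff_dvd_diff algebra_simps)
qed

section \<open>Fibonacci and Lucas numbers at n and 2n\<close>

lemma fib_double: "fib (2 * n) = fib n * (2 * fib (Suc n) - fib n)"
proof (cases n)
  case (Suc k)
  then have "2 * n = Suc (k + n)"
    by simp
  then have "fib (2 * n) = fib (Suc n) * fib (Suc k) + fib n * fib k"
    by (simp only: fib_add)
  also have "\<dots> = fib n * (2 * fib (Suc n) - fib n)"
    by (simp add: Suc algebra_simps)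
  finally show ?thesis .
qed simp

lemma fib_combination_cong:
  fixes q e :: int
  assumes "odd n" "odd q"
    and F: "[int (fib n) = e] (mod q)"
    and F': "[2 * int (fib (Suc n)) = 1 + int (fib n)] (mod q)"
    and e: "e * e = 1 \<or> e = 0 \<and> q = 5"
  shows "[6 * int (fib n) - int (fib (2 * n)) = 5 * e] (mod q ^ 2)"
proof -
  define F L where "F = int (fib n)" and "L = 2 * int (fib (Suc n)) - int (fib n)"
  have "fib n \<le> 2 * fib (Suc n)"
    using fib_Suc_mono[of n] by simp
  then have double: "int (fib (2 * n)) = F * L"
    by (simp add: fib_double F_def L_def of_nat_diff)
  \<comment> \<open>\<open>L\<close> is the n-th Lucas number; the sign comes from \<open>n\<close>
    being odd.\<close>
  have norm: "L ^ 2 - 5 * F ^ 2 = - 4"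
    using fib_Cassini_int[of n] assms(1) by (simp add: F_def L_def power2_eq_square algebra_simps)
  have dvd: "q dvd F - e" "q dvd L - 1"
    using F F' by (simp_all add: F_def L_def cong_iff_dvd_diff algebra_simps)
  show ?thesis
  proof (cases "e = 0")
    case True
    then have "q = 5" using e by auto
    \<comment> \<open>Here 6F - FL = F (5 - (L - 1)), and 5 divides both factors.\<close>
    have "5 dvd 5 - (L - 1)"
      using dvd \<open>q = 5\<close> by (intro dvd_diff[of 5 5 "L - 1"]) auto
    then have "q * q dvd F * (5 - (L - 1))"
      using dvd True \<open>q = 5\<close> by (intro mult_dvd_mono) auto
    then show ?thesis
      unfolding double F_def[symmetric] using True by (simp add: cong_iff_dvd_diff power2_eq_square algebra_simps)
  next
    case False
    then have e2: "e * e = 1" using e by auto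
    have sq: "q ^ 2 dvd (F - e) ^ 2" "q ^ 2 dvd (L - 1) ^ 2"
      using dvd by simp_all
    have "q ^ 2 dvd (L - 1) ^ 2 - 5 * (F - e) ^ 2"
      using sq by (intro dvd_diff dvd_mult)
    also have "(L - 1) ^ 2 - 5 * (F - e) ^ 2 = (L ^ 2 - 5 * F ^ 2) - 2 * L + 1 + 10 * e * F - 5 * (e * e)"
      by (simp add: power2_eq_square algebra_simps)
    also have "\<dots> = 2 * (5 * e * F - L - 4)"
      unfolding norm e2 by simp
    finally have "q ^ 2 dvd 2 * (5 * e * F - L - 4)" .
    moreover have "coprime (q ^ 2) 2"
      using assms(2) by simp
    ultimately have "q ^ 2 dvd 5 * e * F - L - 4"
      by (simp only: coprime_dvd_mult_right_iff)
    \<comment> \<open>Multiplying by \<open>F\<close> brings in F_2n = F L; subtracting the multiple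
      of (F - e)^2 removes the term in F^2.\<close>
    then have "q ^ 2 dvd F * (5 * e * F - L - 4) - 5 * e * (F - e) ^ 2"
      using sq by (intro dvd_diff[of _ "F * (5 * e * F - L - 4)"] dvd_mult)
    also have "F * (5 * e * F - L - 4) - 5 * e * (F - e) ^ 2 = - (4 * F) - F * L + 10 * F * (e * e) - 5 * e * (e * e)"
      by (simp add: power2_eq_square algebra_simps)
    finally show ?thesis
      unfolding e2 double F_def[symmetric] by (simp add: cong_iff_dvd_diff)
  qed
qed

theorem corollary1p3:
  fixes p a :: nat
  assumes "prime p" and "odd p" and "a > 0"
  shows "[(\<Sum>k = 0..p ^ a - 1.
             int ((2 * p ^ a + k) choose k) * int ((2 * k) choose k) * (- 1) ^ k)
          = Jacobi (int (p ^ a)) 5 * (3 - 2 * 5 ^ (p - 1))] (mod (int p)\<^sup>2)"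
proof -
  define n where "n = p ^ a"
  define q where "q = int p"
  define e where "e = Legendre q 5 ^ a"
  define c :: int where "c = 5 ^ ((n - 1) div 2)"
  have n: "odd n" "n > 0"
    using assms by (simp_all add: n_def prime_gt_0_nat)
  have row: "q dvd int (n choose k)" if "0 < k" "k < n" for k
    using prime_power_dvd_choose[OF assms(1)] that by (simp add: n_def q_def)
  have range: "{..<n} = {0..n - 1}"
    using n by auto
  have "[(\<Sum>k<n. int ((2 * n + k) choose k) * int ((2 * k) choose k) * (- 1) ^ k)
      = (\<Sum>k<n. (3 - 2 * ((- 1) ^ k * int ((n - 1) choose k))) * int ((2 * k) choose k) * (- 1) ^ k)] (mod q ^ 2)"
    by (intro cong_sum cong_mult cong_refl choose_double_plus_cong row n) auto
  also have "(\<Sum>k<n. (3 - 2 * ((- 1) ^ k * int ((n - 1) choose k))) * int ((2 * k) choose k) * (- 1) ^ k)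
      = 3 * (\<Sum>k<n. int ((2 * k) choose k) * (- 1) ^ k)
        - 2 * (\<Sum>k<n. int ((n - 1) choose k) * int ((2 * k) choose k))"
    unfolding sum_distrib_left sum_subtractf[symmetric]
    by (rule sum.cong) (auto simp: algebra_simps simp flip: power_add mult_2)
  also have "[3 * (\<Sum>k<n. int ((2 * k) choose k) * (- 1) ^ k)
        - 2 * (\<Sum>k<n. int ((n - 1) choose k) * int ((2 * k) choose k))
      = 3 * (2 * int (fib n) - int (fib (2 * n))) - 2 * (2 * c - int (fib (2 * n)))] (mod q ^ 2)"
  proof (intro cong_diff cong_mult cong_refl)
    show "[(\<Sum>k<n. int ((2 * k) choose k) * (- 1) ^ k) = 2 * int (fib n) - int (fib (2 * n))] (mod q ^ 2)"
      using sum_central_binomial_alternating_cong[OF row n(2,1)] .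
    have "2 * (n - 1) + 2 = 2 * n"
      using n by simp
    then show "[(\<Sum>k<n. int ((n - 1) choose k) * int ((2 * k) choose k)) = 2 * c - int (fib (2 * n))] (mod q ^ 2)"
      using sum_choose_central_binomial_cong[of "n - 1" q] choose_pred_cong[OF row n(2)] n assms(2)
      by (simp add: c_def q_def range atLeast0AtMost)
  qed
  also have "3 * (2 * int (fib n) - int (fib (2 * n))) - 2 * (2 * c - int (fib (2 * n)))
      = (6 * int (fib n) - int (fib (2 * n))) - 2 * (2 * c)"
    by simp
  also have "[\<dots> = 5 * e - 2 * (e * (1 + 5 ^ (p - 1)))] (mod q ^ 2)"
  proof (rule cong_diff[OF _ cong_mult[OF cong_refl]])
    have two: "[2 ^ n = 2] (mod q)"
      using two_power_prime_power_cong[OF assms(1,2)] by (simp add: n_def q_def)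
    have "odd q"
      using assms(2) by (simp add: q_def)
    have c: "[c = e] (mod q)"
      using five_power_half_cong[OF assms(1,2), of a] by (simp add: c_def e_def n_def q_def)
    \<comment> \<open>Offset 0 determines F_n modulo \<open>q\<close>; offset 1 then determines
      F_(n+1).\<close>
    have "[2 * int (fib n) = 2 * c] (mod q)"
      using fib_cong_5_power[OF row n(2,1) two, of 0] by (simp add: c_def mult.commute)
    then have fib_c: "[int (fib n) = c] (mod q)"
      using \<open>odd q\<close> by (simp add: cong_mult_lcancel)
    have "[2 * int (fib (Suc n)) - 1 = c] (mod q)"
      using fib_cong_5_power[OF row n(2,1) two, of 1] by (simp add: c_def numeral_2_eq_2)
    also have "[c = int (fib n)] (mod q)"
      using fib_c by (rule cong_sym)
    finally have "[2 * int (fib (Suc n)) = 1 + int (fib n)] (mod q)"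
      by (simp add: cong_iff_dvd_diff algebra_simps)
    \<comment> \<open>At \<open>p = 5\<close>, \<open>e\<close> is a power of 0, which vanishes
      because \<open>a > 0\<close>.\<close>
    moreover have "e * e = 1 \<or> e = 0 \<and> q = 5"
      using Legendre_5_power_square[OF assms(1), of a] assms(3)
      by (cases "p = 5") (auto simp: e_def q_def Legendre_def cong_0_iff)
    ultimately show "[6 * int (fib n) - int (fib (2 * n)) = 5 * e] (mod q ^ 2)"
      using n(1) \<open>odd q\<close> cong_trans[OF fib_c c] by (intro fib_combination_cong)
    show "[2 * c = e * (1 + 5 ^ (p - 1))] (mod q ^ 2)"
      using five_power_half_double_cong[OF assms] by (simp add: c_def e_def n_def q_def)
  qed
  also have "5 * e - 2 * (e * (1 + 5 ^ (p - 1))) = e * (3 - 2 * 5 ^ (p - 1))"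
    by (simp add: algebra_simps)
  finally show ?thesis
    unfolding Jacobi_power_5 range[symmetric, unfolded n_def] n_def q_def e_def .
qed

end
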